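(* Let $n\ge 1$. There exists a nontrivial involutive Hom-Lie algebra structure on the Heisenberg Lie algebra $\mathfrak{h}_{2n+1}(\mathbb{C})$.
   Context: $\mathfrak{h}_{2n+1}(\mathbb{C})$ is the complex Heisenberg Lie algebra with basis $z,x_1,y_1,\dots,x_n,y_n$ and brackets $[x_i,y_j]=\delta_{ij}z$, all other brackets of basis elements (up to antisymmetry) being zero. A linear map $D:\mathfrak{g}\to\mathfrak{g}$ on a finite-dimensional complex Lie algebra $\mathfrak{g}$ is a Hom-Lie algebra structure on $\mathfrak{g}$ if $[D(x),[y,w]]+[D(y),[w,x]]+[D(w),[x,y]]=0$ for all $x,y,w\in\mathfrak{g}$; it is multiplicative if moreover $D([x,y])=[D(x),D(y)]$ for all $x,y$. An involutive Hom-Lie algebra structure is a multiplicative one with $D^2=\mathrm{id}_{\mathfrak{g}}$. Nontrivial means that $D$ is neither the zero map nor the identity. *)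

theory Defs
  imports "HOL-Analysis.Analysis"
begin

section \<open>Hom-Lie algebra structures on complex Lie algebras\<close>

locale complex_lie_algebra = vector_space scale
  for scale :: "complex \<Rightarrow> 'a::ab_group_add \<Rightarrow> 'a" +
  fixes bracket :: "'a \<Rightarrow> 'a \<Rightarrow> 'a"
  assumes finite_dimensional: "\<exists>B. finite B \<and> span B = UNIV"
    and linear_bracket_left: "Vector_Spaces.linear scale scale (\<lambda>x. bracket x y)"
    and linear_bracket_right: "Vector_Spaces.linear scale scale (\<lambda>y. bracket x y)"
    and bracket_self: "bracket x x = 0"
    and jacobi: "bracket x (bracket y w) + bracket y (bracket w x) + bracket w (bracket x y) = 0"
begin

definition hom_lie_structure :: "('a \<Rightarrow> 'a) \<Rightarrow> bool" where
  "hom_lie_structure D \<longleftrightarrow>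
     Vector_Spaces.linear scale scale D \<and>
     (\<forall>x y w. bracket (D x) (bracket y w) + bracket (D y) (bracket w x)
              + bracket (D w) (bracket x y) = 0)"

definition multiplicative_hom_lie_structure :: "('a \<Rightarrow> 'a) \<Rightarrow> bool" where
  "multiplicative_hom_lie_structure D \<longleftrightarrow>
     hom_lie_structure D \<and> (\<forall>x y. D (bracket x y) = bracket (D x) (D y))"

definition involutive_hom_lie_structure :: "('a \<Rightarrow> 'a) \<Rightarrow> bool" where
  "involutive_hom_lie_structure D \<longleftrightarrow> multiplicative_hom_lie_structure D \<and> D \<circ> D = id"

definition nontrivial :: "('a \<Rightarrow> 'a) \<Rightarrow> bool" where
  "nontrivial D \<longleftrightarrow> D \<noteq> (\<lambda>x. 0) \<and> D \<noteq> id"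

end


section \<open>The Heisenberg Lie algebra\<close>

text \<open>
  The labels of the basis $z, x_1, y_1, \dots, x_n, y_n$. The indices $1, \dots, n$ are
  the elements of a finite type \<open>'n\<close>, so that $n$ is \<open>CARD('n)\<close>; as types are nonempty,
  $n \ge 1$ holds automatically.
\<close>

datatype 'n heisenberg_index = Z | X 'n | Y 'n

lemma UNIV_heisenberg_index: "(UNIV :: 'n heisenberg_index set) = insert Z (range X \<union> range Y)"
proof -
  have "i \<in> insert Z (range X \<union> range Y)" for i :: "'n heisenberg_index"
    by (cases i) auto
  then show ?thesis by auto
qed

instance heisenberg_index :: (finite) finite
  by standard (simp add: UNIV_heisenberg_index)

lemma CARD_heisenberg_index: "CARD('n::finite heisenberg_index) = 2 * CARD('n) + 1"
proof -
  have "card (range X \<union> range Y :: 'n heisenberg_index set) = CARD('n) + CARD('n)"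
    by (subst card_Un_disjoint) (auto simp: card_image inj_on_def)
  moreover have "Z \<notin> (range X \<union> range Y :: 'n heisenberg_index set)" by auto
  ultimately show ?thesis by (simp add: UNIV_heisenberg_index)
qed

type_synonym 'n heisenberg = "complex ^ 'n heisenberg_index"

definition heisenberg_bracket :: "'n::finite heisenberg \<Rightarrow> 'n heisenberg \<Rightarrow> 'n heisenberg" where
  "heisenberg_bracket u v = (\<Sum>i\<in>UNIV. u $ X i * v $ Y i - u $ Y i * v $ X i) *s axis Z 1"

text \<open>
  On the standard basis this is the defining table: $[x_i, y_j] = \delta_{ij} z$, and every
  other bracket not obtained from it by antisymmetry vanishes.
\<close>

lemma heisenberg_bracket_basis:
  "heisenberg_bracket (axis (X i) 1) (axis (Y j) 1) = (if i = j then axis Z 1 else 0)"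
  "heisenberg_bracket (axis (Y j) 1) (axis (X i) 1) = (if i = j then - axis Z 1 else 0)"
  "heisenberg_bracket (axis (X i) 1) (axis (X j) 1) = 0"
  "heisenberg_bracket (axis (Y i) 1) (axis (Y j) 1) = 0"
  "heisenberg_bracket (axis Z 1) v = 0"
  "heisenberg_bracket v (axis Z 1) = 0"
  by (auto simp: heisenberg_bracket_def axis_def vec_eq_iff sum_negf if_distrib
      [where f = "\<lambda>a. a * _"] cong: if_cong)

interpretation heisenberg:
  complex_lie_algebra "(*s)" "heisenberg_bracket :: 'n::finite heisenberg \<Rightarrow> _"
proof
  show "\<exists>B. finite B \<and> vec.span B = (UNIV :: 'n heisenberg set)"
    using vec.finite_Basis vec.span_Basis by blast
  fix x y w :: "'n heisenberg"
  show "heisenberg_bracket x x = 0"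
    by (simp add: heisenberg_bracket_def mult.commute)
  show "heisenberg_bracket x (heisenberg_bracket y w) + heisenberg_bracket y (heisenberg_bracket w x)
        + heisenberg_bracket w (heisenberg_bracket x y) = 0"
    by (simp add: heisenberg_bracket_def axis_def)
qed (auto simp: heisenberg_bracket_def vec_eq_iff algebra_simps sum.distrib sum_subtractf
      sum_distrib_left)

end

theory Submission imports Defs begin

text \<open>
  The Heisenberg algebra is two-step nilpotent: every bracket is a multiple of the central
  element \<open>z\<close>. Each term of the Hom-Lie identity is therefore zero, and every linear map is a
  Hom-Lie structure; only multiplicativity, involutivity and nontriviality constrain \<open>D\<close>.
  The algebra is also graded, with \<open>x\<^sub>i\<close> and \<open>y\<^sub>i\<close> in degree 1 and \<open>z\<close> in degree 2, so the
  map acting as \<open>(-1)^d\<close> in degree \<open>d\<close> is an automorphism. It is an involution that fixes \<open>z\<close>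
  and negates the nonzero vectors \<open>x\<^sub>i\<close>, hence it is neither zero nor the identity.
\<close>

lemma heisenberg_bracket_bracket: "heisenberg_bracket u (heisenberg_bracket v w) = 0"
  by (simp add: heisenberg_bracket_def axis_def)

lemma linear_imp_hom_lie_structure_heisenberg:
  fixes D :: "'n::finite heisenberg \<Rightarrow> 'n heisenberg"
  assumes "Vector_Spaces.linear (*s) (*s) D"
  shows "heisenberg.hom_lie_structure D"
  using assms by (simp add: heisenberg.hom_lie_structure_def heisenberg_bracket_bracket)

definition grading_involution :: "'n::finite heisenberg \<Rightarrow> 'n heisenberg" where
  "grading_involution v = (\<chi> k. if k = Z then v $ k else - v $ k)"

lemma linear_grading_involution: "Vector_Spaces.linear (*s) (*s) grading_involution"
  by standard (auto simp: grading_involution_def vec_eq_iff)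

text \<open>
  The form defining the bracket is bilinear in the degree-1 coordinates, so the two signs
  cancel, in agreement with \<open>z\<close> being fixed.
\<close>

lemma grading_involution_bracket:
  "grading_involution (heisenberg_bracket u v)
    = heisenberg_bracket (grading_involution u) (grading_involution v)"
  by (simp add: grading_involution_def heisenberg_bracket_def vec_eq_iff axis_def)

lemma grading_involution_involutive: "grading_involution \<circ> grading_involution = id"
  by (auto simp: fun_eq_iff grading_involution_def vec_eq_iff)

lemma nontrivial_grading_involution:
  "heisenberg.nontrivial (grading_involution :: 'n::finite heisenberg \<Rightarrow> 'n heisenberg)"
proof -
  have "grading_involution (axis Z 1 :: 'n heisenberg) $ Z \<noteq> 0"
    by (simp add: grading_involution_def)
  then have "(grading_involution :: 'n heisenberg \<Rightarrow> _) \<noteq> (\<lambda>v. 0)"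
    by (metis zero_index)
  moreover have "grading_involution (axis (X i) 1 :: 'n heisenberg) $ X i \<noteq> axis (X i) 1 $ X i" for i
    by (simp add: grading_involution_def)
  then have "(grading_involution :: 'n heisenberg \<Rightarrow> _) \<noteq> id"
    by (metis id_apply)
  ultimately show ?thesis
    by (simp add: heisenberg.nontrivial_def)
qed

theorem corollary4p3:
  "\<exists>D :: 'n::finite heisenberg \<Rightarrow> 'n heisenberg.
     heisenberg.involutive_hom_lie_structure D \<and> heisenberg.nontrivial D"
proof (intro exI conjI)
  show "heisenberg.involutive_hom_lie_structure (grading_involution :: 'n heisenberg \<Rightarrow> _)"
    by (simp add: heisenberg.involutive_hom_lie_structure_def
        heisenberg.multiplicative_hom_lie_structure_def linear_imp_hom_lie_structure_heisenberg
        linear_grading_involution grading_involution_bracket grading_involution_involutive)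
  show "heisenberg.nontrivial (grading_involution :: 'n heisenberg \<Rightarrow> _)"
    by (rule nontrivial_grading_involution)
qed

end
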